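(* Let $N\ge 0$ be an integer and let $Q=(q_{i,j})_{i,j\in\{-N,\dots,N\}}$ be a real symmetric positive (semidefinite) matrix of the form $$q_{i,i}=a_i\ \ \forall i,\qquad q_{i,j}=\frac{b_i-b_j}{i-j}\ \ \forall j\neq i,$$ where $a_i,b_i$ are real numbers with $a_{-i}=a_i$ and $b_{-i}=-b_i$ for all $i\in\{-N,\dots,N\}$. Assume that $\ker Q$ is one-dimensional and even, i.e. $\xi_{-j}=\xi_j$ for all $j$ and all $\xi\in\ker Q$. Let $\xi=(\xi_j)\in\ker Q$, $\xi\neq0$. (i) All the roots of the following polynomial are real: $$P(s)=\sum_{k\in\{-N,\dots,N\}}\xi_k\prod_{j\in\{-N,\dots,N\},\,j\neq k}(j-s).$$ (ii) The Fourier transform $\widehat\xi(z)=\int_{\mathbb{R}}\xi(x)e^{-izx}\,dx$ of the function defined by $$\xi(x):=\sum_{k=-N}^N\xi_k\exp(2\pi i k x)\ \ \forall x\in[0,1],\qquad \xi(x)=0\ \ \forall x\notin[0,1],$$ is entire and has all its zeros on the real line.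
   Context: "Positive" for a real symmetric matrix means positive semidefinite. *)

theory Defs
  imports "HOL-Complex_Analysis.Complex_Analysis" "Jordan_Normal_Form.Matrix_Kernel"
begin

text \<open>
  Families indexed by \<open>{-N..N}\<close> become vectors and matrices of size \<open>2 * N + 1\<close>: row or column
  \<open>r\<close> of the latter carries the index \<open>r - N\<close>. Values of a family outside the index range are
  irrelevant.
\<close>

definition centered_vec :: "nat \<Rightarrow> (int \<Rightarrow> 'a) \<Rightarrow> 'a Matrix.vec" where
  "centered_vec N x = Matrix.vec (2 * N + 1) (\<lambda>r. x (int r - int N))"

definition centered_mat :: "nat \<Rightarrow> (int \<Rightarrow> int \<Rightarrow> 'a) \<Rightarrow> 'a Matrix.mat" where
  "centered_mat N q =
     Matrix.mat (2 * N + 1) (2 * N + 1) (\<lambda>(r, c). q (int r - int N) (int c - int N))"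

definition sym_pos_semidef :: "real Matrix.mat \<Rightarrow> bool" where
  "sym_pos_semidef A \<longleftrightarrow>
     square_mat A \<and> transpose_mat A = A \<and>
     (\<forall>v \<in> carrier_vec (dim_col A). 0 \<le> scalar_prod v (A *\<^sub>v v))"

definition kernel_poly :: "nat \<Rightarrow> (int \<Rightarrow> real) \<Rightarrow> complex poly" where
  "kernel_poly N \<xi> =
     (\<Sum>k\<in>{- int N..int N}.
        Polynomial.smult (of_real (\<xi> k)) (\<Prod>j\<in>{- int N..int N} - {k}. [:of_int j, -1:]))"

definition truncated_trig :: "nat \<Rightarrow> (int \<Rightarrow> real) \<Rightarrow> real \<Rightarrow> complex" where
  "truncated_trig N \<xi> x =
     (if x \<in> {0..1}
      then \<Sum>k\<in>{- int N..int N}. of_real (\<xi> k) * exp (2 * of_real pi * \<i> * of_int k * of_real x)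
      else 0)"

definition fourier_transform :: "(real \<Rightarrow> complex) \<Rightarrow> complex \<Rightarrow> complex" where
  "fourier_transform f z = (LINT x|lborel. f x * exp (- \<i> * z * of_real x))"

end

theory Submission
  imports Defs
begin

text \<open>
  Let \<open>D\<close> be the diagonal matrix of the indices, so that
  \<open>D Q - Q D = b 1\<^sup>T - 1 b\<^sup>T\<close>. If \<open>s\<close> is not real and
  \<open>\<Sum>k. \<xi> k / (k - s) = 0\<close>, then the vector \<open>w k = \<xi> k / (k - s)\<close> satisfies
  \<open>(D - s) w = \<xi>\<close> and \<open>1\<^sup>T w = 0\<close>. Sandwiching the displacement equation between
  \<open>w\<^sup>*\<close> and \<open>w\<close> and using \<open>Q \<xi> = 0\<close> gives
  \<open>(cnj s - s) w\<^sup>* Q w = 0\<close>. By positivity \<open>w\<close> lies in the kernel, hence is even like \<open>\<xi>\<close>,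
  which forces \<open>k \<xi> k = 0\<close> for all \<open>k\<close> and then \<open>\<xi> = 0\<close>. Both the polynomial and the Fourier transform
  are, off the real line, nonvanishing multiples of such a sum of simple fractions.
\<close>

subsection \<open>Quadratic forms and displacement\<close>

text \<open>Perturb \<open>x\<close> in the direction \<open>g = Q x\<close>. As a function of
  \<open>t\<close>, the form at \<open>x + t g\<close> has no constant term and linear coefficient
  twice the squared norm of \<open>g\<close>; a nonzero linear term would make it negative for small
  negative \<open>t\<close>.\<close>

lemma psd_form_zero_imp_kernel:
  fixes q :: "'i \<Rightarrow> 'i \<Rightarrow> real"
  assumes "finite I"
    and sym: "\<And>i j. i \<in> I \<Longrightarrow> j \<in> I \<Longrightarrow> q i j = q j i"
    and psd: "\<And>y. 0 \<le> (\<Sum>i\<in>I. \<Sum>j\<in>I. y i * q i j * y j)"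
    and zero: "(\<Sum>i\<in>I. \<Sum>j\<in>I. x i * q i j * x j) = 0"
    and "i \<in> I"
  shows "(\<Sum>j\<in>I. q i j * x j) = 0"
proof -
  define g where "g i = (\<Sum>j\<in>I. q i j * x j)" for i
  define A where "A = (\<Sum>i\<in>I. (g i)\<^sup>2)"
  define C where "C = (\<Sum>i\<in>I. \<Sum>j\<in>I. g i * q i j * g j)"
  have xg: "(\<Sum>i\<in>I. \<Sum>j\<in>I. x i * q i j * g j) = A"
  proof -
    have "(\<Sum>i\<in>I. \<Sum>j\<in>I. x i * q i j * g j) = (\<Sum>j\<in>I. \<Sum>i\<in>I. x i * q i j * g j)"
      by (rule sum.swap)
    also have "\<dots> = (\<Sum>j\<in>I. g j * g j)"
      unfolding g_def[of j for j] sum_distrib_left sum_distrib_right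
      by (intro sum.cong refl) (simp add: sym mult_ac)
    finally show ?thesis by (simp add: A_def power2_eq_square)
  qed
  have gx: "(\<Sum>i\<in>I. \<Sum>j\<in>I. g i * q i j * x j) = A"
    unfolding A_def power2_eq_square
    by (intro sum.cong refl) (simp add: g_def[of i for i] sum_distrib_left mult_ac)
  have "0 \<le> 2 * t * A + t\<^sup>2 * C" for t
  proof -
    have "(\<Sum>i\<in>I. \<Sum>j\<in>I. (x i + t * g i) * q i j * (x j + t * g j)) =
      (\<Sum>i\<in>I. \<Sum>j\<in>I. x i * q i j * x j) + t * (\<Sum>i\<in>I. \<Sum>j\<in>I. x i * q i j * g j) +
      t * (\<Sum>i\<in>I. \<Sum>j\<in>I. g i * q i j * x j) + t\<^sup>2 * C"
      unfolding C_def sum_distrib_left sum.distrib[symmetric]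
      by (intro sum.cong refl) (simp add: algebra_simps power2_eq_square)
    then show ?thesis
      using psd[of "\<lambda>i. x i + t * g i"] unfolding zero xg gx by (simp add: mult.commute mult.left_commute)
  qed
  note quad = this
  have "A = 0"
  proof (rule ccontr)
    assume "A \<noteq> 0"
    moreover have "0 \<le> A" by (simp add: A_def sum_nonneg)
    ultimately have "A > 0" by simp
    have "C \<ge> 0" using psd[of g] by (simp add: C_def)
    \<comment> \<open>With this \<open>t\<close> the quadratic equals
      \<open>- t\<^sup>2 (C + 2)\<close>. The shift \<open>C + 1\<close> keeps the denominator
      positive when \<open>C = 0\<close>.\<close>
    define t where "t = - A / (C + 1)"
    have "t * (C + 1) = - A"
      using \<open>C \<ge> 0\<close> by (simp add: t_def)
    then have A_eq: "A = - (t * (C + 1))"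
      by simp
    have "2 * t * A + t\<^sup>2 * C = - (t\<^sup>2 * (C + 2))"
      by (subst A_eq) (simp add: algebra_simps power2_eq_square)
    also have "\<dots> < 0"
      using \<open>A > 0\<close> \<open>C \<ge> 0\<close> by (simp add: t_def)
    finally show False using quad[of t] by simp
  qed
  then have "g i = 0"
    using assms(1,5) by (simp add: A_def sum_nonneg_eq_0_iff)
  then show ?thesis by (simp add: g_def)
qed

text \<open>The entries \<open>(i - j) q i j\<close> are summed against
  \<open>cnj (w i) * w j\<close> in two ways: as \<open>b i - b j\<close>, where the total of
  \<open>w\<close> factors out, and by letting \<open>i\<close> and \<open>j\<close> act on the two
  copies of \<open>w\<close>.\<close>

lemma displacement_form_zero:
  fixes q :: "int \<Rightarrow> int \<Rightarrow> real" and b \<xi> :: "int \<Rightarrow> real" and w :: "int \<Rightarrow> complex"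
  assumes sym: "\<And>i j. i \<in> I \<Longrightarrow> j \<in> I \<Longrightarrow> q i j = q j i"
    and disp: "\<And>i j. i \<in> I \<Longrightarrow> j \<in> I \<Longrightarrow> of_int (i - j) * q i j = b i - b j"
    and ker: "\<And>i. i \<in> I \<Longrightarrow> (\<Sum>j\<in>I. q i j * \<xi> j) = 0"
    and w: "\<And>i. i \<in> I \<Longrightarrow> (of_int i - s) * w i = of_real (\<xi> i)"
    and sum_w: "(\<Sum>i\<in>I. w i) = 0"
  shows "(cnj s - s) * (\<Sum>i\<in>I. \<Sum>j\<in>I. cnj (w i) * of_real (q i j) * w j) = 0"
proof -
  have iw: "of_int i * w i = of_real (\<xi> i) + s * w i" if "i \<in> I" for i
    using w[OF that] by (simp add: algebra_simps)
  \<comment> \<open>Since \<open>i\<close> and \<open>\<xi> i\<close> are real, conjugation changes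
    only \<open>s\<close> and \<open>w\<close>; this is the source of the factor
    \<open>cnj s - s\<close>.\<close>
  have iw': "of_int i * cnj (w i) = of_real (\<xi> i) + cnj s * cnj (w i)" if "i \<in> I" for i
    using arg_cong[OF iw[OF that], of cnj] by simp
  have ker': "(\<Sum>j\<in>I. complex_of_real (q i j) * of_real (\<xi> j)) = 0" if "i \<in> I" for i
    using arg_cong[OF ker[OF that], of complex_of_real] by simp
  have ker_right: "(\<Sum>i\<in>I. \<Sum>j\<in>I. cnj (w i) * of_real (q i j) * of_real (\<xi> j)) = 0"
    by (simp add: mult.assoc sum_distrib_left[symmetric] ker')
  \<comment> \<open>Symmetry of \<open>q\<close> turns the left action on \<open>\<xi>\<close> into
    the right one, where the kernel equation applies.\<close>
  have "(\<Sum>i\<in>I. \<Sum>j\<in>I. of_real (\<xi> i) * of_real (q i j) * w j) =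
      (\<Sum>j\<in>I. \<Sum>i\<in>I. w j * (of_real (q j i) * of_real (\<xi> i)))"
    by (subst sum.swap, intro sum.cong refl) (simp add: sym mult_ac)
  then have ker_left: "(\<Sum>i\<in>I. \<Sum>j\<in>I. of_real (\<xi> i) * of_real (q i j) * w j) = 0"
    by (simp add: sum_distrib_left[symmetric] ker')
  have "(\<Sum>i\<in>I. \<Sum>j\<in>I. cnj (w i) * of_real (of_int (i - j) * q i j) * w j) =
      (\<Sum>i\<in>I. \<Sum>j\<in>I. cnj (w i) * of_real (b i - b j) * w j)"
    by (intro sum.cong refl) (simp only: disp)
  also have "\<dots> = (\<Sum>i\<in>I. cnj (w i) * of_real (b i)) * (\<Sum>j\<in>I. w j) -
      cnj (\<Sum>i\<in>I. w i) * (\<Sum>j\<in>I. of_real (b j) * w j)"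
    unfolding cnj_sum sum_product sum_subtractf[symmetric]
    by (intro sum.cong refl) (simp add: algebra_simps)
  also have "\<dots> = 0" by (simp add: sum_w)
  finally have "(\<Sum>i\<in>I. \<Sum>j\<in>I. cnj (w i) * of_real (of_int (i - j) * q i j) * w j) = 0" .
  moreover have "cnj (w i) * of_real (of_int (i - j) * q i j) * w j =
      of_real (\<xi> i) * of_real (q i j) * w j - cnj (w i) * of_real (q i j) * of_real (\<xi> j) +
      (cnj s - s) * (cnj (w i) * of_real (q i j) * w j)" if "i \<in> I" "j \<in> I" for i j
  proof -
    have "cnj (w i) * of_real (of_int (i - j) * q i j) * w j =
        (of_int i * cnj (w i)) * of_real (q i j) * w j -
        cnj (w i) * of_real (q i j) * (of_int j * w j)"
      by (simp add: algebra_simps)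
    then show ?thesis
      unfolding iw[OF that(2)] iw'[OF that(1)] by (simp add: algebra_simps)
  qed
  ultimately have "(\<Sum>i\<in>I. \<Sum>j\<in>I. of_real (\<xi> i) * of_real (q i j) * w j) -
      (\<Sum>i\<in>I. \<Sum>j\<in>I. cnj (w i) * of_real (q i j) * of_real (\<xi> j)) +
      (cnj s - s) * (\<Sum>i\<in>I. \<Sum>j\<in>I. cnj (w i) * of_real (q i j) * w j) = 0"
    by (simp add: sum_subtractf sum.distrib sum_distrib_left cong: sum.cong)
  then show ?thesis by (simp add: ker_left ker_right)
qed

text \<open>Splits the complex form into two real ones, so that positivity and the kernel criterion,
  both stated for real families, apply to \<open>Re w\<close> and \<open>Im w\<close>
  separately.\<close>

lemma Re_hermitian_form:
  fixes q :: "'i \<Rightarrow> 'i \<Rightarrow> real" and w :: "'i \<Rightarrow> complex"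
  shows "Re (\<Sum>i\<in>I. \<Sum>j\<in>I. cnj (w i) * of_real (q i j) * w j) =
    (\<Sum>i\<in>I. \<Sum>j\<in>I. Re (w i) * q i j * Re (w j)) + (\<Sum>i\<in>I. \<Sum>j\<in>I. Im (w i) * q i j * Im (w j))"
  unfolding sum.distrib[symmetric] Re_sum by (intro sum.cong refl) (simp add: algebra_simps)

text \<open>The core to which both halves of the theorem reduce. Evenness is assumed for every real
  kernel family because it is applied to \<open>\<xi>\<close>, \<open>Re w\<close> and
  \<open>Im w\<close>.\<close>

lemma partial_fractions_nonzero:
  fixes q :: "int \<Rightarrow> int \<Rightarrow> real" and b \<xi> :: "int \<Rightarrow> real"
  assumes "finite I"
    and sym: "\<And>i j. i \<in> I \<Longrightarrow> j \<in> I \<Longrightarrow> q i j = q j i"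
    and psd: "\<And>x. 0 \<le> (\<Sum>i\<in>I. \<Sum>j\<in>I. x i * q i j * x j)"
    and disp: "\<And>i j. i \<in> I \<Longrightarrow> j \<in> I \<Longrightarrow> of_int (i - j) * q i j = b i - b j"
    and ker_even: "\<And>\<eta> i. (\<And>i. i \<in> I \<Longrightarrow> (\<Sum>j\<in>I. q i j * \<eta> j) = 0) \<Longrightarrow> i \<in> I \<Longrightarrow> \<eta> (- i) = \<eta> i"
    and ker: "\<And>i. i \<in> I \<Longrightarrow> (\<Sum>j\<in>I. q i j * \<xi> j) = 0"
    and nz: "k \<in> I" "\<xi> k \<noteq> 0"
    and s: "(s :: complex) \<notin> \<real>"
  shows "(\<Sum>i\<in>I. of_real (\<xi> i) / (of_int i - s)) \<noteq> 0"
proof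
  assume sum_zero: "(\<Sum>i\<in>I. of_real (\<xi> i) / (of_int i - s)) = 0"
  define w where "w i = of_real (\<xi> i) / (of_int i - s)" for i
  have ne: "of_int i - s \<noteq> 0" for i
    using s by auto
  have "cnj s \<noteq> s"
    using s by (simp add: Reals_cnj_iff)
  moreover have "(cnj s - s) * (\<Sum>i\<in>I. \<Sum>j\<in>I. cnj (w i) * of_real (q i j) * w j) = 0"
  proof (rule displacement_form_zero[where q = q and b = b and \<xi> = \<xi>])
    show "(of_int i - s) * w i = of_real (\<xi> i)" for i
      using ne by (simp add: w_def)
    show "(\<Sum>i\<in>I. w i) = 0"
      using sum_zero by (simp add: w_def)
  qed (fact sym disp ker)+
  ultimately have "(\<Sum>i\<in>I. \<Sum>j\<in>I. cnj (w i) * of_real (q i j) * w j) = 0"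
    by simp
  then have "(\<Sum>i\<in>I. \<Sum>j\<in>I. Re (w i) * q i j * Re (w j)) +
      (\<Sum>i\<in>I. \<Sum>j\<in>I. Im (w i) * q i j * Im (w j)) = 0"
    using Re_hermitian_form[of w q I] by simp
  then have re: "(\<Sum>i\<in>I. \<Sum>j\<in>I. Re (w i) * q i j * Re (w j)) = 0"
    and im: "(\<Sum>i\<in>I. \<Sum>j\<in>I. Im (w i) * q i j * Im (w j)) = 0"
    using psd[of "\<lambda>i. Re (w i)"] psd[of "\<lambda>i. Im (w i)"] by linarith+
  have w_even: "w (- i) = w i" if "i \<in> I" for i
  proof (rule complex_eqI)
    show "Re (w (- i)) = Re (w i)"
      using ker_even[of "\<lambda>i. Re (w i)"] psd_form_zero_imp_kernel[OF \<open>finite I\<close> sym psd re] that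
      by blast
    show "Im (w (- i)) = Im (w i)"
      using ker_even[of "\<lambda>i. Im (w i)"] psd_form_zero_imp_kernel[OF \<open>finite I\<close> sym psd im] that
      by blast
  qed
  \<comment> \<open>Both \<open>\<xi>\<close> and \<open>w\<close> are even, so
    \<open>\<xi> i\<close> has the same quotient by \<open>i - s\<close> and by
    \<open>- i - s\<close>; these denominators differ unless \<open>i = 0\<close>.\<close>
  have supp: "\<xi> i = 0" if "i \<in> I" "i \<noteq> 0" for i
  proof -
    have "\<xi> (- i) = \<xi> i" using ker_even[of \<xi>] ker that(1) by blast
    then have "of_real (\<xi> i) * (of_int i - s) = of_real (\<xi> i) * (of_int (- i) - s)"
      using w_even[OF that(1)] ne[of i] ne[of "- i"]
      unfolding w_def by (simp add: frac_eq_eq)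
    then show ?thesis using that(2) by simp
  qed
  have "k = 0" using supp nz by blast
  \<comment> \<open>With support reduced to the index 0, the vanishing sum is a single nonzero
    fraction.\<close>
  have "(\<Sum>i\<in>I. w i) = (\<Sum>i\<in>{k}. w i)"
    using nz(1) \<open>finite I\<close> \<open>k = 0\<close> by (intro sum.mono_neutral_right) (auto simp: w_def supp)
  then show False
    using sum_zero ne[of k] nz(2) by (simp add: w_def)
qed

subsection \<open>Families indexed by a centered interval\<close>

lemma sum_centered: "(\<Sum>r\<in>{0..<2 * N + 1}. f (int r - int N)) = (\<Sum>i\<in>{- int N..int N}. f i)"
  by (rule sum.reindex_bij_witness[of _ "\<lambda>i. nat (i + int N)" "\<lambda>r. int r - int N"]) auto

lemma dim_centered [simp]:
  "dim_vec (centered_vec N x) = 2 * N + 1"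
  "dim_row (centered_mat N q) = 2 * N + 1"
  "dim_col (centered_mat N q) = 2 * N + 1"
  by (simp_all add: centered_vec_def centered_mat_def)

lemma centered_vec_carrier [simp]: "centered_vec N x \<in> carrier_vec (2 * N + 1)"
  by (rule carrier_vecI) simp

lemma index_centered [simp]:
  "r < 2 * N + 1 \<Longrightarrow> centered_vec N x $ r = x (int r - int N)"
  "r < 2 * N + 1 \<Longrightarrow> c < 2 * N + 1 \<Longrightarrow> centered_mat N q $$ (r, c) = q (int r - int N) (int c - int N)"
  by (simp_all add: centered_vec_def centered_mat_def)

lemma scalar_prod_centered:
  "scalar_prod (centered_vec N x) (centered_vec N y) = (\<Sum>i\<in>{- int N..int N}. x i * y i)"
  unfolding scalar_prod_def dim_centered sum_centered[symmetric] by (intro sum.cong) auto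

lemma mult_centered:
  "centered_mat N q *\<^sub>v centered_vec N x =
    centered_vec N (\<lambda>i. \<Sum>j\<in>{- int N..int N}. q i j * x j)"
proof (rule eq_vecI)
  fix r assume "r < dim_vec (centered_vec N (\<lambda>i. \<Sum>j\<in>{- int N..int N}. q i j * x j))"
  then have r: "r < 2 * N + 1" by simp
  have "Matrix.row (centered_mat N q) r = centered_vec N (q (int r - int N))"
    using r by (intro eq_vecI) auto
  then show "(centered_mat N q *\<^sub>v centered_vec N x) $ r =
      centered_vec N (\<lambda>i. \<Sum>j\<in>{- int N..int N}. q i j * x j) $ r"
    using r by (simp add: scalar_prod_centered)
qed simp

lemma centered_vec_eq_0_iff:
  "centered_vec N x = 0\<^sub>v (2 * N + 1) \<longleftrightarrow> (\<forall>i\<in>{- int N..int N}. x i = 0)"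
proof
  assume eq: "centered_vec N x = 0\<^sub>v (2 * N + 1)"
  show "\<forall>i\<in>{- int N..int N}. x i = 0"
  proof
    fix i assume i: "i \<in> {- int N..int N}"
    \<comment> \<open>The position \<open>nat (i + int N)\<close> is the row that carries the index
      \<open>i\<close>.\<close>
    then have r: "nat (i + int N) < 2 * N + 1" by auto
    have "centered_vec N x $ nat (i + int N) = 0" using eq r by simp
    then show "x i = 0" using r i by simp
  qed
qed (auto intro!: eq_vecI)

lemma mem_kernel_centered_iff:
  "centered_vec N x \<in> mat_kernel (centered_mat N q) \<longleftrightarrow>
    (\<forall>i\<in>{- int N..int N}. (\<Sum>j\<in>{- int N..int N}. q i j * x j) = 0)"
proof -
  have "centered_vec N x \<in> mat_kernel (centered_mat N q) \<longleftrightarrow>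
      centered_mat N q *\<^sub>v centered_vec N x = 0\<^sub>v (2 * N + 1)"
    unfolding mat_kernel_def dim_centered by (simp only: mem_Collect_eq centered_vec_carrier simp_thms)
  then show ?thesis unfolding mult_centered centered_vec_eq_0_iff .
qed

lemma sym_pos_semidef_centeredD:
  assumes "sym_pos_semidef (centered_mat N q)"
  shows "i \<in> {- int N..int N} \<Longrightarrow> j \<in> {- int N..int N} \<Longrightarrow> q i j = q j i"
    and "0 \<le> (\<Sum>i\<in>{- int N..int N}. \<Sum>j\<in>{- int N..int N}. x i * q i j * x j)"
proof -
  assume ij: "i \<in> {- int N..int N}" "j \<in> {- int N..int N}"
  then have lt: "nat (i + int N) < 2 * N + 1" "nat (j + int N) < 2 * N + 1" by auto
  have "transpose_mat (centered_mat N q) $$ (nat (i + int N), nat (j + int N)) =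
      centered_mat N q $$ (nat (i + int N), nat (j + int N))"
    using assms by (simp add: sym_pos_semidef_def)
  then show "q i j = q j i" using ij lt by simp
next
  have "0 \<le> scalar_prod (centered_vec N x) (centered_mat N q *\<^sub>v centered_vec N x)"
    using assms centered_vec_carrier unfolding sym_pos_semidef_def dim_centered by blast
  then show "0 \<le> (\<Sum>i\<in>{- int N..int N}. \<Sum>j\<in>{- int N..int N}. x i * q i j * x j)"
    unfolding mult_centered scalar_prod_centered by (simp add: sum_distrib_left mult.assoc)
qed

subsection \<open>The polynomial and the Fourier transform as partial fractions\<close>

text \<open>Away from the indices, each product omitting \<open>k\<close> is the full product
  divided by \<open>k - s\<close>, so the full product factors out.\<close>

lemma poly_kernel_poly:
  assumes "\<And>k. k \<in> {- int N..int N} \<Longrightarrow> s \<noteq> of_int k"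
  shows "poly (kernel_poly N \<xi>) s =
    (\<Prod>j\<in>{- int N..int N}. of_int j - s) * (\<Sum>k\<in>{- int N..int N}. of_real (\<xi> k) / (of_int k - s))"
proof -
  have "poly (kernel_poly N \<xi>) s =
      (\<Sum>k\<in>{- int N..int N}. of_real (\<xi> k) * (\<Prod>j\<in>{- int N..int N} - {k}. of_int j - s))"
    by (simp add: kernel_poly_def poly_sum poly_prod)
  also have "\<dots> = (\<Sum>k\<in>{- int N..int N}.
      (\<Prod>j\<in>{- int N..int N}. of_int j - s) * (of_real (\<xi> k) / (of_int k - s)))"
  proof (rule sum.cong[OF refl])
    fix k assume k: "k \<in> {- int N..int N}"
    have "(\<Prod>j\<in>{- int N..int N}. of_int j - s) =
        (of_int k - s) * (\<Prod>j\<in>{- int N..int N} - {k}. of_int j - s)"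
      using k by (intro prod.remove) auto
    then show "of_real (\<xi> k) * (\<Prod>j\<in>{- int N..int N} - {k}. of_int j - s) =
        (\<Prod>j\<in>{- int N..int N}. of_int j - s) * (of_real (\<xi> k) / (of_int k - s))"
      using assms[OF k] by simp
  qed
  finally show ?thesis by (simp add: sum_distrib_left)
qed

text \<open>The integral of \<open>exp (w * x)\<close> over the unit interval; the value 1 at 0
  fills the removable singularity.\<close>

definition exp_quotient :: "complex \<Rightarrow> complex" where
  "exp_quotient w = (if w = 0 then 1 else (exp w - 1) / w)"

text \<open>This is the difference quotient of \<open>exp\<close> at 0, extended by the derivative
  there.\<close>

lemma exp_quotient_holomorphic: "exp_quotient holomorphic_on UNIV"
proof -
  have "(\<lambda>w::complex. if w = 0 then deriv exp 0 else (exp w - exp 0) / (w - 0)) holomorphic_on UNIV"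
    by (rule pole_lemma) (auto intro: holomorphic_intros)
  moreover have "deriv exp (0::complex) = 1"
    by (intro DERIV_imp_deriv) (auto intro!: derivative_eq_intros)
  ultimately show ?thesis by (simp add: exp_quotient_def[abs_def] cong: if_cong)
qed

lemma has_bochner_integral_exp:
  "has_bochner_integral lborel (\<lambda>x. indicator {0..1} x *\<^sub>R exp (w * of_real x)) (exp_quotient w)"
proof (cases "w = 0")
  case True
  then show ?thesis
    using has_bochner_integral_FTC_Icc[of 0 1 "\<lambda>x. complex_of_real x" "\<lambda>x. 1"]
    by (simp add: exp_quotient_def has_vector_derivative_def bounded_linear_imp_has_derivative
        bounded_linear_of_real scaleR_conv_of_real)
next
  case False
  have "has_bochner_integral lborel (\<lambda>x. indicator {0..1} x *\<^sub>R exp (w * of_real x))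
      (exp (w * of_real 1) / w - exp (w * of_real 0) / w)"
  proof (rule has_bochner_integral_FTC_Icc)
    show "((\<lambda>x. exp (w * of_real x) / w) has_vector_derivative exp (w * of_real x)) (at x within {0..1})"
      for x :: real
      by (rule has_vector_derivative_real_field[of "\<lambda>z. exp (w * z) / w"])
        (use False in \<open>auto intro!: derivative_eq_intros\<close>)
  qed (auto intro!: continuous_intros)
  then show ?thesis using False by (simp add: exp_quotient_def diff_divide_distrib)
qed

text \<open>Integrating term by term gives a formula valid for every \<open>z\<close>, including the
  points \<open>2 * pi * k\<close>; the transform is therefore visibly entire.\<close>

lemma fourier_truncated_trig:
  "fourier_transform (truncated_trig N \<xi>) z =
    (\<Sum>k\<in>{- int N..int N}. of_real (\<xi> k) * exp_quotient (\<i> * (2 * of_real pi * of_int k - z)))"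
proof -
  have "has_bochner_integral lborel
      (\<lambda>x. \<Sum>k\<in>{- int N..int N}. of_real (\<xi> k) *
        (indicator {0..1} x *\<^sub>R exp (\<i> * (2 * of_real pi * of_int k - z) * of_real x)))
      (\<Sum>k\<in>{- int N..int N}. of_real (\<xi> k) * exp_quotient (\<i> * (2 * of_real pi * of_int k - z)))"
    by (intro has_bochner_integral_sum has_bochner_integral_mult_right has_bochner_integral_exp)
  moreover have "(\<lambda>x. \<Sum>k\<in>{- int N..int N}. of_real (\<xi> k) *
        (indicator {0..1} x *\<^sub>R exp (\<i> * (2 * of_real pi * of_int k - z) * of_real x))) =
      (\<lambda>x. truncated_trig N \<xi> x * exp (- \<i> * z * of_real x))"
  proof
    fix x :: real
    have "exp (\<i> * (2 * of_real pi * of_int k - z) * of_real x) =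
        exp (2 * of_real pi * \<i> * of_int k * of_real x) * exp (- \<i> * z * of_real x)" for k :: int
      unfolding exp_add[symmetric] by (simp add: algebra_simps)
    then show "(\<Sum>k\<in>{- int N..int N}. of_real (\<xi> k) *
        (indicator {0..1} x *\<^sub>R exp (\<i> * (2 * of_real pi * of_int k - z) * of_real x))) =
      truncated_trig N \<xi> x * exp (- \<i> * z * of_real x)"
      by (simp add: truncated_trig_def indicator_def sum_distrib_right mult.assoc)
  qed
  ultimately show ?thesis
    unfolding fourier_transform_def by (simp add: has_bochner_integral_integral_eq)
qed

text \<open>By periodicity of \<open>exp\<close> all numerators equal
  \<open>exp (- \<i> * z) - 1\<close>, which comes out of the sum and leaves simple fractions at the
  rescaled point \<open>z / (2 * pi)\<close>.\<close>

lemma fourier_truncated_trig_nonreal: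
  assumes "z \<notin> \<real>"
  shows "fourier_transform (truncated_trig N \<xi>) z =
    (exp (- \<i> * z) - 1) / (2 * of_real pi * \<i>) *
    (\<Sum>k\<in>{- int N..int N}. of_real (\<xi> k) / (of_int k - z / (2 * of_real pi)))"
proof -
  have "exp_quotient (\<i> * (2 * of_real pi * of_int k - z)) =
      (exp (- \<i> * z) - 1) / (2 * of_real pi * \<i>) / (of_int k - z / (2 * of_real pi))" for k :: int
  proof -
    have "2 * complex_of_real pi * of_int k \<in> \<real>" by simp
    then have ne: "2 * of_real pi * of_int k - z \<noteq> 0" using assms by auto
    have "exp (\<i> * (2 * of_real pi * of_int k - z)) =
        exp (2 * of_int k * of_real pi * \<i>) * exp (- \<i> * z)"
      unfolding exp_add[symmetric] by (simp add: algebra_simps)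
    then have "exp (\<i> * (2 * of_real pi * of_int k - z)) = exp (- \<i> * z)"
      using exp_integer_2pi[of "of_int k"] by (simp add: mult_ac)
    then have quotient: "exp_quotient (\<i> * (2 * of_real pi * of_int k - z)) =
        (exp (- \<i> * z) - 1) / (\<i> * (2 * of_real pi * of_int k - z))"
      using ne by (simp add: exp_quotient_def)
    have factor: "\<i> * (2 * of_real pi * of_int k - z) =
        2 * of_real pi * \<i> * (of_int k - z / (2 * of_real pi))"
      by (simp add: field_simps)
    show ?thesis unfolding quotient unfolding factor by simp
  qed
  then show ?thesis
    unfolding fourier_truncated_trig by (simp add: sum_distrib_left mult_ac)
qed



theorem theorem5p6:
  fixes N :: nat and q :: "int \<Rightarrow> int \<Rightarrow> real" and a b \<xi> :: "int \<Rightarrow> real"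
  assumes pos: "sym_pos_semidef (centered_mat N q)"
    and diag: "\<And>i. i \<in> {- int N..int N} \<Longrightarrow> q i i = a i"
    and off_diag: "\<And>i j. i \<in> {- int N..int N} \<Longrightarrow> j \<in> {- int N..int N} \<Longrightarrow> j \<noteq> i \<Longrightarrow>
                     q i j = (b i - b j) / of_int (i - j)"
    and a_even: "\<And>i. i \<in> {- int N..int N} \<Longrightarrow> a (- i) = a i"
    and b_odd: "\<And>i. i \<in> {- int N..int N} \<Longrightarrow> b (- i) = - b i"
    and ker_dim: "kernel_dim (centered_mat N q) = 1"
    and ker_even: "\<And>\<eta> j. centered_vec N \<eta> \<in> mat_kernel (centered_mat N q) \<Longrightarrow>
                     j \<in> {- int N..int N} \<Longrightarrow> \<eta> (- j) = \<eta> j"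
    and ker: "centered_vec N \<xi> \<in> mat_kernel (centered_mat N q)"
    and nonzero: "centered_vec N \<xi> \<noteq> 0\<^sub>v (2 * N + 1)"
  shows "(\<forall>s. poly (kernel_poly N \<xi>) s = 0 \<longrightarrow> s \<in> \<real>) \<and>
         fourier_transform (truncated_trig N \<xi>) holomorphic_on UNIV \<and>
         (\<forall>z. fourier_transform (truncated_trig N \<xi>) z = 0 \<longrightarrow> z \<in> \<real>)"
proof (intro conjI allI impI)
  let ?I = "{- int N..int N}"
  \<comment> \<open>Clearing the denominator gives one equation that also covers the diagonal, where
    both sides are 0.\<close>
  have disp: "of_int (i - j) * q i j = b i - b j" if "i \<in> ?I" "j \<in> ?I" for i j
    using off_diag[OF that] by (cases "i = j") auto
  obtain k where k: "k \<in> ?I" "\<xi> k \<noteq> 0"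
    using nonzero unfolding centered_vec_eq_0_iff by blast
  have nonreal: "(\<Sum>i\<in>?I. of_real (\<xi> i) / (of_int i - s)) \<noteq> 0" if "s \<notin> \<real>" for s :: complex
  proof (rule partial_fractions_nonzero[where q = q and b = b and k = k])
    show "\<eta> (- i) = \<eta> i" if "\<And>i. i \<in> ?I \<Longrightarrow> (\<Sum>j\<in>?I. q i j * \<eta> j) = 0" "i \<in> ?I" for \<eta> i
      using ker_even[of \<eta> i] that unfolding mem_kernel_centered_iff by blast
    show "(\<Sum>j\<in>?I. q i j * \<xi> j) = 0" if "i \<in> ?I" for i
      using ker that unfolding mem_kernel_centered_iff by blast
  qed (fact finite_atLeastAtMost_int disp k that sym_pos_semidef_centeredD[OF pos])+
  show "s \<in> \<real>" if "poly (kernel_poly N \<xi>) s = 0" for s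
  proof (rule ccontr)
    assume s: "s \<notin> \<real>"
    \<comment> \<open>A non-real \<open>s\<close> is no index, so the product in the factorization
      is nonzero too.\<close>
    then have "s \<noteq> of_int i" "of_int i - s \<noteq> 0" for i by auto
    then show False
      using that nonreal[OF s] by (simp add: poly_kernel_poly del: right_minus_eq)
  qed
  show "fourier_transform (truncated_trig N \<xi>) holomorphic_on UNIV"
  proof -
    have "(exp_quotient \<circ> (\<lambda>z. \<i> * (2 * of_real pi * of_int i - z))) holomorphic_on UNIV" for i :: int
      by (rule holomorphic_on_compose_gen[OF _ exp_quotient_holomorphic])
        (auto intro!: holomorphic_intros)
    then show ?thesis
      unfolding fourier_truncated_trig[abs_def] o_def by (intro holomorphic_intros)
  qed
  show "z \<in> \<real>" if "fourier_transform (truncated_trig N \<xi>) z = 0" for z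
  proof (rule ccontr)
    assume z: "z \<notin> \<real>"
    have "z / (2 * of_real pi) \<notin> \<real>"
    proof
      assume "z / (2 * of_real pi) \<in> \<real>"
      then have "z / (2 * of_real pi) * (2 * of_real pi) \<in> \<real>" by (intro Reals_mult) auto
      then show False using z by simp
    qed
    \<comment> \<open>The value 1 would force \<open>z\<close> to be a real multiple of
      \<open>2 * pi\<close>; hence neither factor of the transform vanishes.\<close>
    moreover have "exp (- \<i> * z) \<noteq> 1"
      using z by (auto simp: exp_eq_1 complex_is_Real_iff)
    ultimately show False
      using that nonreal unfolding fourier_truncated_trig_nonreal[OF z] by simp
  qed
qed

end
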